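(* For every hermitian positive semidefinite matrix $A\in\mathbb{C}^{n\times n}$, there exists a vector $v\in\mathbb{C}^n$ such that $A\succeq vv^\dagger$ and \[ c^n\,\mathrm{per}(vv^\dagger)\ \ge\ \mathrm{rel}(A), \] where $c=e^{\gamma+1}$ and $\gamma$ is Euler's constant.
   Context: For $M\in\mathbb{C}^{n\times n}$, $\mathrm{per}(M)=\sum_{\sigma\in S_n}\prod_{i=1}^n M_{i,\sigma(i)}$. $v^\dagger$ denotes the conjugate transpose. For hermitian matrices, $X\succeq Y$ means $X-Y$ is positive semidefinite. For an $n\times n$ hermitian PSD matrix $A$, $\mathrm{rel}(A):=\inf\{\mathrm{per}(D): D \text{ diagonal},\ D\succeq A\}$. *)

theory Defs
  imports "HOL-Analysis.Analysis"
begin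

definition per :: "'a::comm_ring_1^'n^'n \<Rightarrow> 'a" where
  "per M = (\<Sum>\<sigma> | \<sigma> permutes (UNIV :: 'n set). \<Prod>i\<in>UNIV. M $ i $ \<sigma> i)"

definition conj_transpose :: "complex^'n^'m \<Rightarrow> complex^'m^'n" where
  "conj_transpose M = (\<chi> i j. cnj (M $ j $ i))"

definition hermitian :: "complex^'n^'n \<Rightarrow> bool" where
  "hermitian M \<longleftrightarrow> conj_transpose M = M"

text \<open>The value $x^\dagger M x$; it is real when \<open>M\<close> is hermitian
  (lemma \<open>quad_form_real\<close>), so taking its real part in \<open>psd\<close> loses nothing.\<close>

definition quad_form :: "complex^'n^'n \<Rightarrow> complex^'n \<Rightarrow> complex" where
  "quad_form M x = (\<Sum>i\<in>UNIV. cnj (x $ i) * (M *v x) $ i)"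

definition psd :: "complex^'n^'n \<Rightarrow> bool" where
  "psd M \<longleftrightarrow> hermitian M \<and> (\<forall>x. 0 \<le> Re (quad_form M x))"

definition loewner_ge :: "complex^'n^'n \<Rightarrow> complex^'n^'n \<Rightarrow> bool" (infix \<open>\<succeq>\<close> 50) where
  "X \<succeq> Y \<longleftrightarrow> hermitian X \<and> hermitian Y \<and> psd (X - Y)"

definition diagonal :: "'a::zero^'n^'n \<Rightarrow> bool" where
  "diagonal D \<longleftrightarrow> (\<forall>i j. i \<noteq> j \<longrightarrow> D $ i $ j = 0)"

text \<open>$v v^\dagger$\<close>

definition outer :: "complex^'n \<Rightarrow> complex^'n^'n" where
  "outer v = (\<chi> i j. v $ i * cnj (v $ j))"

text \<open>For psd \<open>A\<close>, all the permanents occurring here are nonnegative reals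
  (lemma \<open>per_rel_real\<close>), and the set is nonempty and bounded below
  (lemmas \<open>rel_set_nonempty\<close> and \<open>rel_set_bdd_below\<close>), so this is the genuine infimum.\<close>

definition rel :: "complex^'n^'n \<Rightarrow> real" where
  "rel A = Inf {Re (per D) | D. diagonal D \<and> D \<succeq> A}"

lemma quad_form_expand:
  "quad_form M x = (\<Sum>i\<in>UNIV. \<Sum>j\<in>UNIV. cnj (x $ i) * M $ i $ j * x $ j)"
  by (simp add: quad_form_def matrix_vector_mult_def sum_distrib_left mult.assoc)

lemma hermitian_iff: "hermitian M \<longleftrightarrow> (\<forall>i j. cnj (M $ j $ i) = M $ i $ j)"
  by (simp add: hermitian_def conj_transpose_def vec_eq_iff)

lemma quad_form_real:
  assumes "hermitian M"
  shows "quad_form M x \<in> \<real>"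
proof -
  have h: "\<And>i j. cnj (M $ j $ i) = M $ i $ j"
    using assms by (simp add: hermitian_iff)
  have "cnj (quad_form M x) = (\<Sum>i\<in>UNIV. \<Sum>j\<in>UNIV. x $ i * M $ j $ i * cnj (x $ j))"
    by (simp add: quad_form_expand h)
  also have "\<dots> = (\<Sum>j\<in>UNIV. \<Sum>i\<in>UNIV. x $ i * M $ j $ i * cnj (x $ j))"
    by (rule sum.swap)
  also have "\<dots> = quad_form M x"
    by (simp add: quad_form_expand mult_ac)
  finally show ?thesis
    by (simp add: Reals_cnj_iff)
qed

lemma per_diagonal:
  fixes D :: "'a::comm_ring_1^'n^'n"
  assumes "diagonal D"
  shows "per D = (\<Prod>i\<in>UNIV. D $ i $ i)"
proof -
  have "(\<Prod>i\<in>UNIV. D $ i $ \<sigma> i) = 0" if "\<sigma> \<noteq> id" for \<sigma>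
  proof -
    from that obtain i where "\<sigma> i \<noteq> i" by (metis eq_id_iff)
    then have "D $ i $ \<sigma> i = 0" using assms by (auto simp: diagonal_def)
    then show ?thesis by (intro prod_zero) auto
  qed
  then have "per D = (\<Sum>\<sigma>\<in>{id}. \<Prod>i\<in>UNIV. D $ i $ \<sigma> i)"
    unfolding per_def
    by (intro sum.mono_neutral_right) (auto simp: permutes_id finite_permutations)
  then show ?thesis by simp
qed

lemma per_outer: "per (outer (v :: complex^'n)) = of_real (fact CARD('n) * (\<Prod>i\<in>UNIV. (cmod (v $ i))\<^sup>2))"
proof -
  have "(\<Prod>i\<in>UNIV. outer v $ i $ \<sigma> i) = (\<Prod>i\<in>UNIV. of_real ((cmod (v $ i))\<^sup>2))"
    if "\<sigma> permutes UNIV" for \<sigma>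
  proof -
    have "(\<Prod>i\<in>UNIV. cnj (v $ \<sigma> i)) = (\<Prod>i\<in>UNIV. cnj (v $ i))"
      using prod.permute[OF that, of "\<lambda>i. cnj (v $ i)"] by (simp add: o_def)
    then show ?thesis
      by (simp add: outer_def prod.distrib complex_norm_square del: of_real_power)
  qed
  then have "per (outer v) = (\<Sum>\<sigma> | \<sigma> permutes (UNIV :: 'n set). \<Prod>i\<in>UNIV. of_real ((cmod (v $ i))\<^sup>2))"
    unfolding per_def by (intro sum.cong) auto
  then show ?thesis
    by (simp add: card_permutations[of UNIV "CARD('n)"])
qed

lemma psd_diag_nonneg:
  assumes "psd M"
  shows "M $ i $ i \<in> \<real>" "0 \<le> Re (M $ i $ i)"
proof -
  have "quad_form M (axis i 1) = M $ i $ i"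
    by (simp add: quad_form_expand axis_def if_distrib[of cnj] if_distrib[of "\<lambda>x. x * _"]
        if_distrib[of "\<lambda>x. _ * x"] cong: if_cong)
  then show "0 \<le> Re (M $ i $ i)" "M $ i $ i \<in> \<real>"
    using assms quad_form_real[of M "axis i 1"] by (auto simp: psd_def dest: spec[of _ "axis i 1"])
qed

lemma per_rel_real:
  assumes "psd A" "diagonal D" "D \<succeq> A"
  shows "per D \<in> \<real>" "0 \<le> Re (per D)"
proof -
  have d: "D $ i $ i = of_real (Re (D $ i $ i)) \<and> 0 \<le> Re (D $ i $ i)" for i
  proof -
    have "D $ i $ i = (D - A) $ i $ i + A $ i $ i" by simp
    moreover have "(D - A) $ i $ i \<in> \<real>" "0 \<le> Re ((D - A) $ i $ i)"
      using assms(3) psd_diag_nonneg unfolding loewner_ge_def by blast+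
    moreover have "A $ i $ i \<in> \<real>" "0 \<le> Re (A $ i $ i)"
      using assms(1) psd_diag_nonneg by blast+
    ultimately have "D $ i $ i \<in> \<real>" "0 \<le> Re (D $ i $ i)"
      by (metis Reals_add, simp)
    then show ?thesis by (simp add: of_real_Re)
  qed
  have "per D = (\<Prod>i\<in>UNIV. of_real (Re (D $ i $ i)))"
    using d by (simp add: per_diagonal[OF assms(2)])
  then have "per D = of_real (\<Prod>i\<in>UNIV. Re (D $ i $ i))" by simp
  moreover have "0 \<le> (\<Prod>i\<in>UNIV. Re (D $ i $ i))"
    using d by (intro prod_nonneg) auto
  ultimately show "per D \<in> \<real>" "0 \<le> Re (per D)"
    by (metis Reals_of_real, metis Re_complex_of_real)
qed

lemma rel_set_bdd_below:
  assumes "psd A"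
  shows "bdd_below {Re (per D) | D. diagonal D \<and> D \<succeq> A}"
  by (rule bdd_belowI[of _ 0]) (auto intro: per_rel_real[OF assms])

lemma rel_set_nonempty:
  fixes A :: "complex^'n^'n"
  assumes "psd A"
  shows "{Re (per D) | D. diagonal D \<and> D \<succeq> A} \<noteq> {}"
proof -
  define K where "K = (\<Sum>i\<in>UNIV. \<Sum>j\<in>UNIV. cmod (A $ i $ j))"
  define D :: "complex^'n^'n" where "D = mat (of_real K)"
  have hA: "hermitian A" using assms by (simp add: psd_def)
  have hD: "hermitian D" by (auto simp: hermitian_iff D_def mat_def)
  have hDA: "hermitian (D - A)" using hA hD by (simp add: hermitian_iff)
  have "0 \<le> Re (quad_form (D - A) x)" for x
  proof -
    define S where "S = (\<Sum>i\<in>UNIV. (cmod (x $ i))\<^sup>2)"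
    have le: "cmod (x $ i) * cmod (x $ j) \<le> S" for i j
    proof -
      have le1: "(cmod (x $ k))\<^sup>2 \<le> S" for k
        unfolding S_def by (rule member_le_sum) auto
      have "2 * (cmod (x $ i) * cmod (x $ j)) \<le> (cmod (x $ i))\<^sup>2 + (cmod (x $ j))\<^sup>2"
        using sum_squares_bound[of "cmod (x $ i)" "cmod (x $ j)"] by (simp add: mult_ac)
      then show ?thesis using le1[of i] le1[of j] by linarith
    qed
    have "Re (quad_form A x) \<le> cmod (quad_form A x)" by (rule complex_Re_le_cmod)
    also have "\<dots> \<le> (\<Sum>i\<in>UNIV. \<Sum>j\<in>UNIV. cmod (cnj (x $ i) * A $ i $ j * x $ j))"
      unfolding quad_form_expand by (intro order_trans[OF norm_sum] sum_mono norm_sum)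
    also have "\<dots> \<le> (\<Sum>i\<in>UNIV. \<Sum>j\<in>UNIV. cmod (A $ i $ j) * S)"
    proof (intro sum_mono)
      fix i j
      have "cmod (A $ i $ j) * (cmod (x $ i) * cmod (x $ j)) \<le> cmod (A $ i $ j) * S"
        by (intro mult_left_mono le) auto
      then show "cmod (cnj (x $ i) * A $ i $ j * x $ j) \<le> cmod (A $ i $ j) * S"
        by (simp add: norm_mult mult_ac)
    qed
    also have "\<dots> = K * S" by (simp add: K_def sum_distrib_right)
    finally have 1: "Re (quad_form A x) \<le> K * S" .
    have "quad_form D x = (\<Sum>i\<in>UNIV. cnj (x $ i) * of_real K * x $ i)"
      by (simp add: quad_form_expand D_def mat_def if_distrib[of "\<lambda>x. x * _"]
          if_distrib[of "\<lambda>x. _ * x"] cong: if_cong)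
    also have "\<dots> = (\<Sum>i\<in>UNIV. of_real (K * (cmod (x $ i))\<^sup>2))"
      by (intro sum.cong refl) (simp add: complex_norm_square mult_ac del: of_real_power)
    also have "\<dots> = of_real (K * S)" by (simp add: S_def sum_distrib_left)
    finally have 2: "Re (quad_form D x) = K * S" by simp
    have "quad_form (D - A) x = quad_form D x - quad_form A x"
      by (simp add: quad_form_expand algebra_simps sum_subtractf)
    then show ?thesis using 1 2 by simp
  qed
  then have "D \<succeq> A" using hA hD hDA by (simp add: loewner_ge_def psd_def)
  moreover have "diagonal D" by (simp add: diagonal_def D_def mat_def)
  ultimately show ?thesis by blast
qed

end

theory Submission
  imports Defs
begin

text \<open>If some diagonal entry of \<open>A\<close> vanishes then \<open>rel A = 0\<close> and \<open>v = 0\<close> works. Otherwise the infimum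
  is attained at some positive \<open>d\<close>, and first-order optimality says that the barycentre \<open>(1/n, \<dots>, 1/n)\<close>
  is a convex combination of vectors \<open>(d\<^sub>i |w\<^sub>i|\<^sup>2)\<^sub>i\<close> with \<open>w\<close> in the kernel of \<open>diag d - A\<close> and
  \<open>\<Sum>\<^sub>i d\<^sub>i |w\<^sub>i|\<^sup>2 = 1\<close>. For such \<open>w\<close>, Cauchy-Schwarz for \<open>A\<close> shows that \<open>A\<close> dominates \<open>y y\<^sup>\<dagger>\<close> with
  \<open>y = A w = diag d w\<close>, so it remains to make \<open>\<Prod>\<^sub>i d\<^sub>i |w\<^sub>i|\<^sup>2\<close> large. A complex Gaussian combination of
  the vectors \<open>w\<close> makes each \<open>p\<^sub>i = d\<^sub>i |w\<^sub>i|\<^sup>2\<close> exponentially distributed with mean 1 (up to a common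
  factor), so \<open>\<Sum>\<^sub>i ln p\<^sub>i - n ln (\<Sum>\<^sub>i p\<^sub>i / n)\<close> is at least \<open>-n \<gamma>\<close> in expectation; the remaining factor
  \<open>e\<^sup>n\<close> is \<open>n\<^sup>n / n! \<le> e\<^sup>n\<close>.

  To work with nonnegative integrands only, \<open>ln p\<close> is replaced by its lower bound \<open>(1 - p\<^sup>-\<^sup>s) / s\<close>, whose
  expectation \<open>(1 - \<Gamma>(1 - s)) / s\<close> tends to \<open>-\<gamma>\<close> as \<open>s\<close> tends to 0; compactness of the set of
  admissible \<open>w\<close> removes the resulting error.\<close>

section \<open>Lebesgue measure on the complex plane: discs, shears and rotations\<close>

text \<open>The disc of squared radius \<open>t\<close> has area \<open>pi * t\<close>, so the image
  of planar Lebesgue measure under the squared modulus has constant density \<open>pi\<close> on the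
  nonnegative half-line. The sets \<open>{..t}\<close> form an intersection-stable generator on
  which the two measures agree and are finite.\<close>

lemma nn_integral_cmod_square:
  fixes f :: "real \<Rightarrow> ennreal"
  assumes [measurable]: "f \<in> borel_measurable borel"
  shows "(\<integral>\<^sup>+z. f ((cmod z)\<^sup>2) \<partial>lborel) = ennreal pi * (\<integral>\<^sup>+t. f t * indicator {0..} t \<partial>lborel)"
proof -
  let ?M = "distr lborel borel (\<lambda>z::complex. (cmod z)\<^sup>2)"
  let ?N = "density lborel (\<lambda>t::real. ennreal pi * indicator {0..} t)"
  have M: "emeasure ?M {..t} = ennreal (pi * max 0 t)" for t
  proof (cases "t < 0")
    case True
    have "\<not> (cmod z)\<^sup>2 \<le> t" for z
      using less_le_trans[OF True zero_le_power2] by (simp add: not_le)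
    then have "(\<lambda>z::complex. (cmod z)\<^sup>2) -` {..t} = {}"
      by auto
    with True show ?thesis by (simp add: emeasure_distr)
  next
    case False
    then have "(\<lambda>z::complex. (cmod z)\<^sup>2) -` {..t} = cball 0 (sqrt t)"
      by (auto simp: real_le_rsqrt) (metis norm_ge_zero real_sqrt_le_iff real_sqrt_unique)
    with False show ?thesis
      by (simp add: emeasure_distr emeasure_cball unit_ball_vol_2)
  qed
  have N: "emeasure ?N {..t} = ennreal (pi * max 0 t)" for t
  proof -
    have "emeasure ?N {..t} = (\<integral>\<^sup>+x. ennreal pi * indicator {0..t} x \<partial>lborel)"
      by (subst emeasure_density) (auto intro!: nn_integral_cong split: split_indicator)
    then show ?thesis
      by (cases "t < 0") (auto simp: nn_integral_cmult ennreal_mult max_def)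
  qed
  have "?M = ?N"
  proof (rule measure_eqI_generator_eq[where E = "range (\<lambda>t. {..t})" and \<Omega> = UNIV and A = "\<lambda>n. {..real n}"])
    show "Int_stable (range (\<lambda>t::real. {..t}))"
      by (auto simp: Int_stable_def)
    show "sets ?M = sigma_sets UNIV (range (\<lambda>t. {..t}))" "sets ?N = sigma_sets UNIV (range (\<lambda>t. {..t}))"
      by (simp_all add: borel_eq_atMost)
    show "(\<Union>n. {..real n}) = UNIV"
      using real_arch_simple by auto
  qed (auto simp: M N)
  moreover have "(\<integral>\<^sup>+z. f ((cmod z)\<^sup>2) \<partial>lborel) = integral\<^sup>N ?M f"
    by (simp add: nn_integral_distr)
  moreover have "integral\<^sup>N ?N f = ennreal pi * (\<integral>\<^sup>+t. f t * indicator {0..} t \<partial>lborel)"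
    by (simp add: nn_integral_density nn_integral_cmult mult_ac flip: nn_integral_cmult)
  ultimately show ?thesis by simp
qed

lemma nn_integral_lborel_translate:
  fixes c :: "'a::euclidean_space"
  assumes [measurable]: "f \<in> borel_measurable borel"
  shows "(\<integral>\<^sup>+x. f (x + c) \<partial>lborel) = (\<integral>\<^sup>+x. f x \<partial>lborel)"
proof -
  have "integral\<^sup>N (distr lborel borel ((+) c)) f = (\<integral>\<^sup>+x. f (x + c) \<partial>lborel)"
    by (simp add: nn_integral_distr add.commute)
  then show ?thesis by (simp add: lborel_distr_plus)
qed

lemma nn_integral_lborel_swap:
  fixes F :: "'a::euclidean_space \<times> 'b::euclidean_space \<Rightarrow> ennreal"
  assumes [measurable]: "F \<in> borel_measurable borel"
  shows "(\<integral>\<^sup>+x. \<integral>\<^sup>+y. F (x, y) \<partial>lborel \<partial>lborel) = (\<integral>\<^sup>+y. \<integral>\<^sup>+x. F (x, y) \<partial>lborel \<partial>lborel)"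
  by (rule lborel_pair.Fubini'[symmetric]) (simp add: lborel_prod)

text \<open>A matrix of determinant one with non-zero off-diagonal entry is a product of three shears,
  and each shear preserves Lebesgue measure by Fubini and translation invariance.\<close>

lemma nn_integral_complex_rotation:
  fixes F :: "complex \<times> complex \<Rightarrow> ennreal"
  assumes F: "F \<in> borel_measurable borel"
    and ab: "(cmod a)\<^sup>2 + (cmod b)\<^sup>2 = 1" and b: "b \<noteq> 0"
  shows "(\<integral>\<^sup>+x. \<integral>\<^sup>+y. F (a * x + b * y, cnj a * y - cnj b * x) \<partial>lborel \<partial>lborel) =
         (\<integral>\<^sup>+x. \<integral>\<^sup>+y. F (x, y) \<partial>lborel \<partial>lborel)"
proof -
  have shear1: "(\<integral>\<^sup>+x. \<integral>\<^sup>+y. H (x + c * y, y) \<partial>lborel \<partial>lborel) = (\<integral>\<^sup>+x. \<integral>\<^sup>+y. H (x, y) \<partial>lborel \<partial>lborel)"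
    if [measurable]: "H \<in> borel_measurable borel" for H :: "complex \<times> complex \<Rightarrow> ennreal" and c
  proof -
    have "(\<lambda>p. H (fst p + c * snd p, snd p)) \<in> borel_measurable borel"
      by (rule measurable_compose[OF _ that], intro borel_measurable_continuous_onI continuous_intros)
    from nn_integral_lborel_swap[OF this] have
      "(\<integral>\<^sup>+x. \<integral>\<^sup>+y. H (x + c * y, y) \<partial>lborel \<partial>lborel) = (\<integral>\<^sup>+y. \<integral>\<^sup>+x. H (x + c * y, y) \<partial>lborel \<partial>lborel)"
      by simp
    also have "\<dots> = (\<integral>\<^sup>+y. \<integral>\<^sup>+x. H (x, y) \<partial>lborel \<partial>lborel)"
      by (intro nn_integral_cong nn_integral_lborel_translate measurable_compose[OF _ that]
          borel_measurable_continuous_onI continuous_intros)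
    finally show ?thesis
      by (simp add: nn_integral_lborel_swap)
  qed
  have shear2: "(\<integral>\<^sup>+x. \<integral>\<^sup>+y. H (x, y + c * x) \<partial>lborel \<partial>lborel) = (\<integral>\<^sup>+x. \<integral>\<^sup>+y. H (x, y) \<partial>lborel \<partial>lborel)"
    if H: "H \<in> borel_measurable borel" for H :: "complex \<times> complex \<Rightarrow> ennreal" and c
    by (intro nn_integral_cong nn_integral_lborel_translate[where f = "\<lambda>y. H (x, y)" for x]
        measurable_compose[OF _ H] borel_measurable_continuous_onI continuous_intros)
  \<comment> \<open>The matrix with rows \<open>(a, b)\<close> and \<open>(- cnj b, cnj a)\<close>
    is factored as upper shear \<open>p\<close>, lower shear \<open>q\<close>, upper shear
    \<open>r\<close>. Three entries fix the parameters; the fourth, \<open>a * r + p = b\<close>,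
    follows from the determinant being 1.\<close>
  define q p r where "q = - cnj b" and "p = (a - 1) / q" and "r = (cnj a - 1) / q"
  have q: "q \<noteq> 0" using b by (simp add: q_def)
  define G where "G = (\<lambda>w::complex\<times>complex. F (fst w + p * snd w, snd w))"
  define H where "H = (\<lambda>w::complex\<times>complex. G (fst w, snd w + q * fst w))"
  have G: "G \<in> borel_measurable borel" unfolding G_def
    by (rule measurable_compose[OF _ F], intro borel_measurable_continuous_onI continuous_intros)
  have H: "H \<in> borel_measurable borel" unfolding H_def
    by (rule measurable_compose[OF _ G], intro borel_measurable_continuous_onI continuous_intros)
  have ab': "a * cnj a + b * cnj b = 1"
    using ab by (metis complex_norm_square of_real_1 of_real_add)
  have eq: "H (x + r * y, y) = F (a * x + b * y, cnj a * y - cnj b * x)" for x y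
  proof -
    have pq: "p * q = a - 1" and rq: "q * r = cnj a - 1"
      using q by (auto simp: p_def r_def)
    have "q * (a * r + p) = q * b"
      using ab' pq rq q_def by algebra
    then have 1: "a * r + p = b" using q by simp
    have 2: "y + q * (x + r * y) = cnj a * y - cnj b * x"
      using rq q_def by algebra
    have 3: "x + r * y + p * (y + q * (x + r * y)) = a * x + b * y"
    proof -
      have "x + r * y + p * (y + q * (x + r * y)) = x + r * y + p * y + (p * q) * (x + r * y)"
        by (simp add: algebra_simps)
      also have "\<dots> = a * x + (a * r + p) * y"
        unfolding pq by (simp add: algebra_simps)
      finally show ?thesis using 1 by simp
    qed
    show ?thesis using 2 3 by (simp add: H_def G_def)
  qed
  have "(\<integral>\<^sup>+x. \<integral>\<^sup>+y. F (a * x + b * y, cnj a * y - cnj b * x) \<partial>lborel \<partial>lborel) =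
      (\<integral>\<^sup>+x. \<integral>\<^sup>+y. H (x, y) \<partial>lborel \<partial>lborel)"
    using shear1[OF H, of r] by (simp add: eq)
  also have "\<dots> = (\<integral>\<^sup>+x. \<integral>\<^sup>+y. G (x, y) \<partial>lborel \<partial>lborel)"
    using shear2[OF G, of q] by (simp add: H_def)
  also have "\<dots> = (\<integral>\<^sup>+x. \<integral>\<^sup>+y. F (x, y) \<partial>lborel \<partial>lborel)"
    using shear1[OF F, of p] by (simp add: G_def)
  finally show ?thesis .
qed

section \<open>The standard complex Gaussian measure\<close>

text \<open>Normalised so that the squared modulus is exponentially distributed with mean 1, which
  turns its moments into values of Gamma.\<close>

definition gauss :: "complex measure" where
  "gauss = density lborel (\<lambda>z. ennreal (exp (- (cmod z)\<^sup>2) / pi))"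

lemma sets_gauss [simp, measurable_cong]: "sets gauss = sets borel"
  by (simp add: gauss_def)

lemma space_gauss [simp]: "space gauss = UNIV"
  by (simp add: gauss_def)

lemma nn_integral_gauss:
  assumes [measurable]: "f \<in> borel_measurable borel"
  shows "(\<integral>\<^sup>+z. f z \<partial>gauss) = (\<integral>\<^sup>+z. ennreal (exp (- (cmod z)\<^sup>2) / pi) * f z \<partial>lborel)"
  unfolding gauss_def by (rule nn_integral_density) auto

lemma nn_integral_gauss_cmod_square:
  assumes [measurable]: "f \<in> borel_measurable borel"
  shows "(\<integral>\<^sup>+z. f ((cmod z)\<^sup>2) \<partial>gauss) = (\<integral>\<^sup>+t. ennreal (exp (- t)) * f t * indicator {0..} t \<partial>lborel)"
proof -
  have "(\<integral>\<^sup>+z. f ((cmod z)\<^sup>2) \<partial>gauss) = (\<integral>\<^sup>+z. ennreal (exp (- (cmod z)\<^sup>2) / pi) * f ((cmod z)\<^sup>2) \<partial>lborel)"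
    by (simp add: nn_integral_gauss)
  also have "\<dots> = ennreal pi * (\<integral>\<^sup>+t. ennreal (exp (- t) / pi) * f t * indicator {0..} t \<partial>lborel)"
    by (rule nn_integral_cmod_square[where f = "\<lambda>t. ennreal (exp (- t) / pi) * f t"]) auto
  also have "\<dots> = (\<integral>\<^sup>+t. (ennreal pi * ennreal (exp (- t) / pi)) * f t * indicator {0..} t \<partial>lborel)"
    by (subst nn_integral_cmult[symmetric]) (auto simp: mult_ac)
  also have "\<dots> = (\<integral>\<^sup>+t. ennreal (exp (- t)) * f t * indicator {0..} t \<partial>lborel)"
    by (simp flip: ennreal_mult)
  finally show ?thesis .
qed

lemma nn_integral_gauss_powr:
  assumes "- 1 < s"
  shows "(\<integral>\<^sup>+z. ennreal ((cmod z)\<^sup>2 powr s) \<partial>gauss) = ennreal (Gamma (1 + s))"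
proof -
  have "(\<integral>\<^sup>+z. ennreal ((cmod z)\<^sup>2 powr s) \<partial>gauss) =
      (\<integral>\<^sup>+t. ennreal (exp (- t)) * ennreal (t powr s) * indicator {0..} t \<partial>lborel)"
    by (rule nn_integral_gauss_cmod_square) auto
  also have "\<dots> = (\<integral>\<^sup>+t. ennreal (t powr (1 + s - 1) / exp t) * indicator {0..} t \<partial>lborel)"
    by (intro nn_integral_cong) (simp add: exp_minus field_simps flip: ennreal_mult)
  also have "\<dots> = ennreal (Gamma (1 + s))"
    using assms by (intro nn_integral_has_integral_lebesgue' Gamma_integral_real) auto
  finally show ?thesis .
qed

lemma emeasure_gauss_UNIV: "emeasure gauss UNIV = 1"
proof -
  have "emeasure gauss UNIV = (\<integral>\<^sup>+z. 1 \<partial>gauss)" by simp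
  also have "\<dots> = (\<integral>\<^sup>+t. ennreal (exp (- t)) * 1 * indicator {0..} t \<partial>lborel)"
    by (rule nn_integral_gauss_cmod_square) auto
  \<comment> \<open>The two integrands differ at \<open>t = 0\<close>, because
    \<open>0 powr 0\<close> is 0; hence the equality almost everywhere.\<close>
  also have "\<dots> = (\<integral>\<^sup>+t. ennreal (t powr (1 - 1) / exp t) * indicator {0..} t \<partial>lborel)"
    by (intro nn_integral_cong_AE AE_I[of _ _ "{0}"])
       (auto simp: exp_minus field_simps split: split_indicator)
  also have "\<dots> = ennreal (Gamma 1)"
    by (intro nn_integral_has_integral_lebesgue' Gamma_integral_real) auto
  finally show ?thesis by simp
qed

text \<open>Unlike \<open>x powr - s\<close>, which is 0 at \<open>x = 0\<close>, the inverse in \<^typ>\<open>ennreal\<close> is infinite there, so a finite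
  value of the integrand certifies that \<open>z\<close> is non-zero.\<close>

lemma nn_integral_gauss_inverse_powr:
  assumes "0 < s" "s < 1"
  shows "(\<integral>\<^sup>+z. inverse (ennreal ((cmod z)\<^sup>2 powr s)) \<partial>gauss) = ennreal (Gamma (1 - s))"
proof -
  have "AE z in gauss. z \<noteq> 0"
    unfolding gauss_def
    by (subst AE_density) (auto intro!: AE_I[of _ _ "{0}"])
  then have "(\<integral>\<^sup>+z. inverse (ennreal ((cmod z)\<^sup>2 powr s)) \<partial>gauss) =
      (\<integral>\<^sup>+z. ennreal ((cmod z)\<^sup>2 powr - s) \<partial>gauss)"
    by (intro nn_integral_cong_AE) (auto simp: inverse_ennreal powr_minus elim!: eventually_mono)
  then show ?thesis
    using nn_integral_gauss_powr[of "- s"] assms by simp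
qed


interpretation gauss: finite_measure gauss
  by (rule finite_measureI) (simp add: emeasure_gauss_UNIV)

interpretation gauss_product: product_sigma_finite "\<lambda>_. gauss"
  by standard

text \<open>The product density depends only on \<open>(cmod x)\<^sup>2 + (cmod y)\<^sup>2\<close>.
  After scaling the coefficients to unit length, a unitary change of variables makes the combination
  the first coordinate, and the second integrates out to 1.\<close>

lemma nn_integral_gauss_pair:
  fixes f :: "complex \<Rightarrow> ennreal"
  assumes f [measurable]: "f \<in> borel_measurable borel"
  shows "(\<integral>\<^sup>+x. \<integral>\<^sup>+y. f (a * x + b * y) \<partial>gauss \<partial>gauss) =
         (\<integral>\<^sup>+z. f (of_real (sqrt ((cmod a)\<^sup>2 + (cmod b)\<^sup>2)) * z) \<partial>gauss)"
proof -
  define g where "g = (\<lambda>z. ennreal (exp (- (cmod z)\<^sup>2) / pi))"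
  have [measurable]: "g \<in> borel_measurable borel" by (simp add: g_def)
  have g1: "(\<integral>\<^sup>+z. g z \<partial>lborel) = 1"
    using nn_integral_gauss[of "\<lambda>_. 1"] emeasure_gauss_UNIV by (simp add: g_def)
  have unit: "(\<integral>\<^sup>+x. \<integral>\<^sup>+y. h (c * x + d * y) \<partial>gauss \<partial>gauss) = (\<integral>\<^sup>+z. h z \<partial>gauss)"
    if [measurable]: "h \<in> borel_measurable borel" and cd: "(cmod c)\<^sup>2 + (cmod d)\<^sup>2 = 1" and d: "d \<noteq> 0"
    for h :: "complex \<Rightarrow> ennreal" and c d
  proof -
    define F where "F = (\<lambda>w. h (fst w) * (g (fst w) * g (snd w)))"
    have F [measurable]: "F \<in> borel_measurable borel"
      unfolding F_def borel_prod[symmetric] by measurable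
    have norm_eq: "(cmod (c * x + d * y))\<^sup>2 + (cmod (cnj c * y - cnj d * x))\<^sup>2 = (cmod x)\<^sup>2 + (cmod y)\<^sup>2" for x y
    proof -
      have "c * cnj c + d * cnj d = 1"
        using cd by (metis complex_norm_square of_real_1 of_real_add)
      then have "(c * x + d * y) * cnj (c * x + d * y) + (cnj c * y - cnj d * x) * cnj (cnj c * y - cnj d * x)
          = x * cnj x + y * cnj y"
        unfolding complex_cnj_add complex_cnj_diff complex_cnj_mult complex_cnj_cnj by algebra
      then have "complex_of_real ((cmod (c * x + d * y))\<^sup>2 + (cmod (cnj c * y - cnj d * x))\<^sup>2) =
          complex_of_real ((cmod x)\<^sup>2 + (cmod y)\<^sup>2)"
        unfolding of_real_add complex_norm_square .
      then show ?thesis using of_real_eq_iff by blast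
    qed
    have gmul: "g x * g y = ennreal (exp (- ((cmod x)\<^sup>2 + (cmod y)\<^sup>2)) / pi\<^sup>2)" for x y
      by (simp add: g_def power2_eq_square mult_exp_exp flip: ennreal_mult)
    have gg: "g x * g y = g (c * x + d * y) * g (cnj c * y - cnj d * x)" for x y
      by (simp only: gmul norm_eq)
    have "(\<integral>\<^sup>+x. \<integral>\<^sup>+y. h (c * x + d * y) \<partial>gauss \<partial>gauss) =
        (\<integral>\<^sup>+x. g x * (\<integral>\<^sup>+y. g y * h (c * x + d * y) \<partial>lborel) \<partial>lborel)"
      by (simp add: nn_integral_gauss g_def)
    also have "\<dots> = (\<integral>\<^sup>+x. \<integral>\<^sup>+y. g x * g y * h (c * x + d * y) \<partial>lborel \<partial>lborel)"
      by (simp add: nn_integral_cmult mult.assoc)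
    also have "\<dots> = (\<integral>\<^sup>+x. \<integral>\<^sup>+y. F (c * x + d * y, cnj c * y - cnj d * x) \<partial>lborel \<partial>lborel)"
      unfolding F_def fst_conv snd_conv gg[symmetric] by (simp add: mult_ac)
    also have "\<dots> = (\<integral>\<^sup>+x. \<integral>\<^sup>+y. F (x, y) \<partial>lborel \<partial>lborel)"
      by (rule nn_integral_complex_rotation[OF F cd d])
    also have "\<dots> = (\<integral>\<^sup>+x. h x * g x * (\<integral>\<^sup>+y. g y \<partial>lborel) \<partial>lborel)"
      by (simp add: F_def nn_integral_cmult flip: mult.assoc)
    also have "\<dots> = (\<integral>\<^sup>+x. h x \<partial>gauss)"
      unfolding g1 by (simp add: nn_integral_gauss g_def mult.commute)
    finally show ?thesis .
  qed
  have nonzero: "(\<integral>\<^sup>+x. \<integral>\<^sup>+y. f (a * x + b * y) \<partial>gauss \<partial>gauss) =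
         (\<integral>\<^sup>+z. f (of_real (sqrt ((cmod a)\<^sup>2 + (cmod b)\<^sup>2)) * z) \<partial>gauss)" if b: "b \<noteq> 0" for a b
  proof -
    define r where "r = sqrt ((cmod a)\<^sup>2 + (cmod b)\<^sup>2)"
    have r: "r > 0" "r\<^sup>2 = (cmod a)\<^sup>2 + (cmod b)\<^sup>2"
      using b by (auto simp: r_def intro: add_nonneg_pos)
    have "(cmod (a / of_real r))\<^sup>2 + (cmod (b / of_real r))\<^sup>2 = 1"
      using r b by (simp add: norm_divide power_divide flip: add_divide_distrib)
    then have "(\<integral>\<^sup>+x. \<integral>\<^sup>+y. f (of_real r * (a / of_real r * x + b / of_real r * y)) \<partial>gauss \<partial>gauss) =
        (\<integral>\<^sup>+z. f (of_real r * z) \<partial>gauss)"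
      using b r by (intro unit) auto
    moreover have "of_real r * (a / of_real r * x + b / of_real r * y) = a * x + b * y" for x y
      using r by (simp add: field_simps)
    ultimately show ?thesis by (simp add: r_def)
  qed
  show ?thesis
  proof (cases "b = 0")
    case False
    then show ?thesis by (rule nonzero)
  next
    case True
    show ?thesis
    proof (cases "a = 0")
      case True
      with \<open>b = 0\<close> show ?thesis by (simp add: emeasure_gauss_UNIV)
    next
      case False
      \<comment> \<open>The rotation needs a non-zero second coefficient, so the roles of
        \<open>a\<close> and \<open>b\<close> are exchanged; as \<open>b = 0\<close>, both iterated
        integrals collapse to the same single one.\<close>
      have "(\<integral>\<^sup>+x. \<integral>\<^sup>+y. f (a * x + b * y) \<partial>gauss \<partial>gauss) = (\<integral>\<^sup>+y. \<integral>\<^sup>+x. f (b * y + a * x) \<partial>gauss \<partial>gauss)"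
        using \<open>b = 0\<close> by (simp add: emeasure_gauss_UNIV)
      with nonzero[OF False, of b] show ?thesis by (simp add: add.commute)
    qed
  qed
qed

lemma nn_integral_gauss_PiM:
  fixes f :: "complex \<Rightarrow> ennreal" and u :: "'j \<Rightarrow> complex"
  assumes "finite J" and "f \<in> borel_measurable borel"
  shows "(\<integral>\<^sup>+x. f (\<Sum>j\<in>J. u j * x j) \<partial>PiM J (\<lambda>_. gauss)) =
         (\<integral>\<^sup>+z. f (of_real (sqrt (\<Sum>j\<in>J. (cmod (u j))\<^sup>2)) * z) \<partial>gauss)"
  using assms
proof (induction J arbitrary: f rule: finite_induct)
  case empty
  then show ?case
    by (simp add: PiM_empty nn_integral_count_space_finite emeasure_gauss_UNIV)
next
  case (insert k J)
  note [measurable] = insert.prems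
  define r where "r = sqrt (\<Sum>j\<in>J. (cmod (u j))\<^sup>2)"
  have r2: "(cmod (of_real r))\<^sup>2 = (\<Sum>j\<in>J. (cmod (u j))\<^sup>2)"
    unfolding r_def by (simp add: sum_nonneg)
  have "(\<integral>\<^sup>+x. f (\<Sum>j\<in>insert k J. u j * x j) \<partial>PiM (insert k J) (\<lambda>_. gauss)) =
      (\<integral>\<^sup>+y. \<integral>\<^sup>+x. f (\<Sum>j\<in>insert k J. u j * (x(k := y)) j) \<partial>PiM J (\<lambda>_. gauss) \<partial>gauss)"
    using insert.hyps by (intro gauss_product.product_nn_integral_insert_rev) auto
  also have "\<dots> = (\<integral>\<^sup>+y. \<integral>\<^sup>+x. f (u k * y + (\<Sum>j\<in>J. u j * x j)) \<partial>PiM J (\<lambda>_. gauss) \<partial>gauss)"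
  proof -
    have "(\<Sum>j\<in>insert k J. u j * (x(k := y)) j) = u k * y + (\<Sum>j\<in>J. u j * x j)" for x y
      using insert.hyps by (simp, intro sum.cong) auto
    then show ?thesis by simp
  qed
  \<comment> \<open>The induction hypothesis is applied to \<open>f\<close> translated by
    \<open>u k * y\<close>, which is why \<open>f\<close> is generalised.\<close>
  also have "\<dots> = (\<integral>\<^sup>+y. \<integral>\<^sup>+z. f (u k * y + of_real r * z) \<partial>gauss \<partial>gauss)"
    unfolding r_def by (intro nn_integral_cong insert.IH) auto
  also have "\<dots> = (\<integral>\<^sup>+z. f (of_real (sqrt ((cmod (u k))\<^sup>2 + (cmod (of_real r))\<^sup>2)) * z) \<partial>gauss)"
    by (rule nn_integral_gauss_pair) (rule insert.prems)
  finally show ?case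
    using insert.hyps unfolding r2 by simp
qed


section \<open>Choosing a good Gaussian sample\<close>

text \<open>First moment method: a function exceeding \<open>c\<close> everywhere on a probability
  space has integral exceeding \<open>c\<close>.\<close>

lemma exists_le_nn_integral:
  assumes M: "emeasure M (space M) = 1" and f [measurable]: "f \<in> borel_measurable M"
    and le: "(\<integral>\<^sup>+x. f x \<partial>M) \<le> ennreal c"
  shows "\<exists>x\<in>space M. f x \<le> ennreal c"
proof (rule ccontr)
  assume "\<not> ?thesis"
  then have gt: "ennreal c < f x" if "x \<in> space M" for x
    using that by (auto simp: not_le)
  have "(\<integral>\<^sup>+x. ennreal c \<partial>M) < (\<integral>\<^sup>+x. f x \<partial>M)"
  proof (rule nn_integral_less)
    show "AE x in M. ennreal c \<le> f x"
      using gt by (intro AE_I2) (auto intro: less_imp_le)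
    show "\<not> (AE x in M. f x \<le> ennreal c)"
    proof
      assume "AE x in M. f x \<le> ennreal c"
      then have "AE x in M. False"
        using gt by (auto elim!: AE_mp intro!: AE_I2 simp: not_le[symmetric])
      then show False
        using M by (simp add: AE_iff_measurable[OF sets.top])
    qed
  qed (auto simp: M)
  with le show False by (simp add: M)
qed

text \<open>Rows of unit length make every combination a standard Gaussian, so each summand has mean
  \<open>Gamma (1 - s) / s + 1\<close>. Linearity of expectation copes with any dependence between
  different \<open>i\<close>, and the first moment method yields the sample.\<close>

lemma gauss_combination_bound:
  fixes u :: "'i \<Rightarrow> 'j \<Rightarrow> complex" and J :: "'j set"
  defines "p \<equiv> \<lambda>x i. (cmod (\<Sum>j\<in>J. u i j * x j))\<^sup>2"
  assumes I: "finite I" and J: "finite J"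
    and u: "\<And>i. i \<in> I \<Longrightarrow> (\<Sum>j\<in>J. (cmod (u i j))\<^sup>2) = 1"
    and s: "0 < s" "s < 1"
  shows "\<exists>x. (\<forall>i\<in>I. 0 < p x i) \<and>
    (\<Sum>i\<in>I. p x i powr - s / s + p x i) \<le> card I * (Gamma (1 - s) / s + 1)"
proof -
  let ?M = "PiM J (\<lambda>_. gauss)"
  let ?f = "\<lambda>x i. inverse (ennreal (p x i powr s)) * ennreal (1 / s) + ennreal (p x i)"
  interpret P: finite_product_sigma_finite "\<lambda>_. gauss" J
    by standard (rule J)
  have 1: "emeasure ?M (space ?M) = 1"
    unfolding space_PiM by (subst P.measure_times) (auto simp: emeasure_gauss_UNIV)
  have [measurable]: "(\<lambda>x. p x i) \<in> borel_measurable ?M" for i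
    unfolding p_def by measurable
  have G: "0 < Gamma (1 - s)" using s by (intro Gamma_real_pos) auto
  have "(\<integral>\<^sup>+x. ?f x i \<partial>?M) = ennreal (Gamma (1 - s) / s + 1)" if "i \<in> I" for i
  proof -
    have inv: "(\<integral>\<^sup>+x. inverse (ennreal (p x i powr s)) \<partial>?M) = ennreal (Gamma (1 - s))"
      unfolding p_def
      using nn_integral_gauss_PiM[OF J, of "\<lambda>z. inverse (ennreal ((cmod z)\<^sup>2 powr s))" "u i"]
        u[OF that] nn_integral_gauss_inverse_powr[OF s] by simp
    have sq: "(\<integral>\<^sup>+x. ennreal (p x i) \<partial>?M) = 1"
      unfolding p_def
      using nn_integral_gauss_PiM[OF J, of "\<lambda>z. ennreal ((cmod z)\<^sup>2)" "u i"]
        u[OF that] nn_integral_gauss_powr[of 1] Gamma_fact[of 1, where 'a = real] by simp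
    show ?thesis
      using s G by (simp add: nn_integral_add nn_integral_multc inv sq less_imp_le flip: ennreal_mult)
  qed
  then have "(\<integral>\<^sup>+x. (\<Sum>i\<in>I. ?f x i) \<partial>?M) = (\<Sum>i\<in>I. ennreal (Gamma (1 - s) / s + 1))"
    by (subst nn_integral_sum) auto
  also have "\<dots> = ennreal (card I * (Gamma (1 - s) / s + 1))"
    using s G by (simp add: ennreal_mult ennreal_of_nat_eq_real_of_nat)
  finally obtain x where x: "(\<Sum>i\<in>I. ?f x i) \<le> ennreal (card I * (Gamma (1 - s) / s + 1))"
    using exists_le_nn_integral[OF 1, of "\<lambda>x. \<Sum>i\<in>I. ?f x i"] by auto
  have pos: "0 < p x i" if "i \<in> I" for i
  proof (rule ccontr)
    assume "\<not> 0 < p x i"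
    then have "p x i = 0" by (auto simp: p_def)
    then have "?f x i = top" using s by (simp add: ennreal_top_mult)
    moreover have "?f x i \<le> (\<Sum>i\<in>I. ?f x i)"
      using that I by (intro member_le_sum) auto
    ultimately show False using x by (auto simp: top_unique)
  qed
  have "(\<Sum>i\<in>I. ?f x i) = (\<Sum>i\<in>I. ennreal (p x i powr - s / s + p x i))"
  proof (intro sum.cong refl)
    fix i assume "i \<in> I"
    from pos[OF this] show "?f x i = ennreal (p x i powr - s / s + p x i)"
      using s by (simp add: inverse_ennreal powr_minus divide_inverse flip: ennreal_mult ennreal_plus)
  qed
  also have "\<dots> = ennreal (\<Sum>i\<in>I. p x i powr - s / s + p x i)"
    using pos s by (intro sum_ennreal) (auto intro!: add_nonneg_nonneg simp: less_imp_le)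
  finally have eq: "(\<Sum>i\<in>I. ?f x i) = ennreal (\<Sum>i\<in>I. p x i powr - s / s + p x i)" .
  have "0 \<le> card I * (Gamma (1 - s) / s + 1)"
    using s G by (intro mult_nonneg_nonneg add_nonneg_nonneg divide_nonneg_nonneg) auto
  with x[unfolded eq] have "(\<Sum>i\<in>I. p x i powr - s / s + p x i) \<le> card I * (Gamma (1 - s) / s + 1)"
    by (simp only: ennreal_le_iff)
  with pos show ?thesis by blast
qed

text \<open>The limit is minus the derivative of Gamma at 1.\<close>

lemma Gamma_difference_quotient_at_1:
  "((\<lambda>s. (Gamma (1 - s) - 1) / s) \<longlongrightarrow> (euler_mascheroni :: real)) (at_right 0)"
proof -
  have "((\<lambda>s. Gamma (1 - s)) has_real_derivative euler_mascheroni) (at 0)"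
    by (auto intro!: derivative_eq_intros)
  then show ?thesis
    unfolding DERIV_def by (auto intro: tendsto_mono[OF at_le])
qed

text \<open>Both sides are homogeneous of the same degree in \<open>p\<close>, so the bound survives
  the later normalisation of the random vector.\<close>

lemma gauss_combination_prod_ge:
  fixes u :: "'i \<Rightarrow> 'j \<Rightarrow> complex" and J :: "'j set"
  defines "p \<equiv> \<lambda>x i. (cmod (\<Sum>j\<in>J. u i j * x j))\<^sup>2"
  assumes I: "finite I" "I \<noteq> {}" and J: "finite J"
    and u: "\<And>i. i \<in> I \<Longrightarrow> (\<Sum>j\<in>J. (cmod (u i j))\<^sup>2) = 1"
    and c: "euler_mascheroni < c"
  shows "\<exists>x. (\<forall>i\<in>I. 0 < p x i) \<and>
    exp (- c) ^ card I * ((\<Sum>i\<in>I. p x i) / card I) ^ card I \<le> (\<Prod>i\<in>I. p x i)"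
proof -
  \<comment> \<open>The gap between \<open>c\<close> and Euler's constant leaves room for a positive
    \<open>s\<close>.\<close>
  have "eventually (\<lambda>s. (Gamma (1 - s) - 1) / s < c \<and> 0 < s \<and> s < (1::real)) (at_right 0)"
    using order_tendstoD(2)[OF Gamma_difference_quotient_at_1 c]
      eventually_at_right_real[OF zero_less_one] by eventually_elim auto
  then obtain s :: real where s: "(Gamma (1 - s) - 1) / s < c" "0 < s" "s < 1"
    using eventually_happens' trivial_limit_at_right_real by blast
  from gauss_combination_bound[of I J u s, OF I(1) J u s(2,3)] obtain x where pos: "\<And>i. i \<in> I \<Longrightarrow> 0 < p x i"
    and le: "(\<Sum>i\<in>I. p x i powr - s / s + p x i) \<le> card I * (Gamma (1 - s) / s + 1)"
    unfolding p_def by blast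
  let ?n = "real (card I)" and ?m = "(\<Sum>i\<in>I. p x i) / card I"
  have n: "0 < ?n" using I by (simp add: card_gt_0_iff)
  have m: "0 < ?m" using I pos n by (intro divide_pos_pos sum_pos) auto
  have "1 / s - ln (p x i) \<le> p x i powr - s / s" if "i \<in> I" for i
  proof -
    \<comment> \<open>Tangent line of \<open>exp\<close> at 0, evaluated at
      \<open>- s * ln (p x i)\<close>.\<close>
    have "1 - s * ln (p x i) \<le> p x i powr - s"
      using pos[OF that] exp_ge_add_one_self[of "- s * ln (p x i)"] by (simp add: powr_def)
    from divide_right_mono[OF this, of s] show ?thesis
      using s by (simp add: diff_divide_distrib)
  qed
  then have "(\<Sum>i\<in>I. 1 / s - ln (p x i) + p x i) \<le> (\<Sum>i\<in>I. p x i powr - s / s + p x i)"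
    by (intro sum_mono add_right_mono) auto
  with le have "?n / s - (\<Sum>i\<in>I. ln (p x i)) + ?n * ?m \<le> ?n * (Gamma (1 - s) / s + 1)"
    using n by (simp add: sum.distrib sum_subtractf)
  then have "?n * (?m - 1) - ?n * ((Gamma (1 - s) - 1) / s) \<le> (\<Sum>i\<in>I. ln (p x i))"
    by (simp add: algebra_simps diff_divide_distrib)
  \<comment> \<open>The mean entered linearly through the summand \<open>p x i\<close>; the tangent
    line of \<open>ln\<close> at 1 turns it into the logarithm needed for homogeneity.\<close>
  moreover have "?n * ln ?m \<le> ?n * (?m - 1)"
    using n m by (intro mult_left_mono ln_le_minus_one) auto
  moreover have "?n * ((Gamma (1 - s) - 1) / s) \<le> ?n * c"
    using n s by (intro mult_left_mono) auto
  ultimately have "?n * (- c) + ?n * ln ?m \<le> (\<Sum>i\<in>I. ln (p x i))"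
    by simp
  then have "exp (?n * (- c) + ?n * ln ?m) \<le> exp (\<Sum>i\<in>I. ln (p x i))"
    by simp
  also have "exp (\<Sum>i\<in>I. ln (p x i)) = (\<Prod>i\<in>I. p x i)"
    using pos I by (simp add: exp_sum)
  also have "exp (?n * (- c) + ?n * ln ?m) = exp (- c) ^ card I * ?m ^ card I"
    using m by (simp only: exp_add exp_of_nat_mult exp_ln)
  finally show ?thesis using pos by blast
qed

section \<open>Positive semidefinite forms and feasible diagonals\<close>

text \<open>The polarisation of \<open>quad_form\<close>, conjugate-linear in the first
  argument.\<close>

definition sesq :: "complex^'n^'n \<Rightarrow> complex^'n \<Rightarrow> complex^'n \<Rightarrow> complex" where
  "sesq M x y = (\<Sum>i\<in>UNIV. cnj (x $ i) * (M *v y) $ i)"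

lemma quad_form_eq_sesq: "quad_form M x = sesq M x x"
  by (simp add: quad_form_def sesq_def)

lemma sesq_add_left: "sesq M (x + y) z = sesq M x z + sesq M y z"
  by (simp add: sesq_def algebra_simps sum.distrib)

lemma sesq_add_right: "sesq M x (y + z) = sesq M x y + sesq M x z"
  by (simp add: sesq_def matrix_vector_right_distrib algebra_simps sum.distrib)

lemma sesq_scale_left: "sesq M (c *s x) y = cnj c * sesq M x y"
  by (simp add: sesq_def sum_distrib_left mult_ac)

lemma sesq_scale_right: "sesq M x (c *s y) = c * sesq M x y"
  by (simp add: sesq_def vector_scalar_commute sum_distrib_left mult_ac)

lemma cnj_sesq:
  assumes "hermitian M"
  shows "cnj (sesq M x y) = sesq M y x"
proof -
  have h: "cnj (M $ i $ j) = M $ j $ i" for i j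
    using assms by (simp add: hermitian_iff)
  have "cnj (sesq M x y) = (\<Sum>i\<in>UNIV. \<Sum>j\<in>UNIV. x $ i * M $ j $ i * cnj (y $ j))"
    by (simp add: sesq_def matrix_vector_mult_def sum_distrib_left h mult_ac)
  also have "\<dots> = (\<Sum>j\<in>UNIV. \<Sum>i\<in>UNIV. x $ i * M $ j $ i * cnj (y $ j))"
    by (rule sum.swap)
  also have "\<dots> = sesq M y x"
    by (simp add: sesq_def matrix_vector_mult_def sum_distrib_left mult_ac)
  finally show ?thesis .
qed

lemma quad_form_scale: "Re (quad_form M (c *s x)) = (cmod c)\<^sup>2 * Re (quad_form M x)"
proof -
  have "quad_form M (c *s x) = (c * cnj c) * quad_form M x"
    by (simp add: quad_form_eq_sesq sesq_scale_left sesq_scale_right mult_ac)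
  then show ?thesis
    by (simp add: complex_norm_square[symmetric] del: of_real_power)
qed

lemma psd_cauchy_schwarz:
  assumes "psd M"
  shows "(cmod (sesq M x y))\<^sup>2 \<le> Re (quad_form M x) * Re (quad_form M y)"
proof -
  have herm: "hermitian M" and nonneg: "\<And>x. 0 \<le> Re (quad_form M x)"
    using assms by (auto simp: psd_def)
  define b where "b = (cmod (sesq M x y))\<^sup>2"
  have ge: "0 \<le> Re (quad_form M x) - 2 * t * b + t\<^sup>2 * b * Re (quad_form M y)" for t :: real
  proof -
    \<comment> \<open>This phase makes the cross term real and equal to \<open>- t * b\<close>,
      leaving a real quadratic in \<open>t\<close>.\<close>
    define c where "c = - of_real t * cnj (sesq M x y)"
    have "quad_form M (x + c *s y) = quad_form M x + (c * sesq M x y + cnj (c * sesq M x y)) + quad_form M (c *s y)"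
      using cnj_sesq[OF herm, of x y]
      by (simp add: quad_form_eq_sesq sesq_add_left sesq_add_right sesq_scale_left sesq_scale_right algebra_simps)
    also have "c * sesq M x y = - of_real (t * b)"
      unfolding c_def b_def of_real_mult complex_norm_square by simp
    finally have "Re (quad_form M (x + c *s y)) = Re (quad_form M x) - 2 * t * b + (cmod c)\<^sup>2 * Re (quad_form M y)"
      by (simp add: quad_form_scale)
    moreover have "(cmod c)\<^sup>2 = t\<^sup>2 * b"
      by (simp add: c_def b_def norm_mult power_mult_distrib)
    ultimately show ?thesis
      using nonneg[of "x + c *s y"] by simp
  qed
  show ?thesis
  proof (cases "Re (quad_form M y) = 0")
    case True
    \<comment> \<open>Without a quadratic term the expression is affine in \<open>t\<close>; if
      \<open>b\<close> were positive, the chosen \<open>t\<close> would give it the value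
      -1.\<close>
    have "b = 0"
    proof (rule ccontr)
      assume "b \<noteq> 0"
      then have "b > 0" by (simp add: b_def)
      then show False
        using ge[of "(Re (quad_form M x) + 1) / (2 * b)"] True by simp
    qed
    then show ?thesis using True by (simp add: b_def)
  next
    case False
    with nonneg[of y] have pos: "0 < Re (quad_form M y)" by simp
    \<comment> \<open>This \<open>t\<close> minimises the quadratic when \<open>b\<close> is
      positive.\<close>
    with ge[of "1 / Re (quad_form M y)"] have "b / Re (quad_form M y) \<le> Re (quad_form M x)"
      by (simp add: power2_eq_square)
    with pos show ?thesis by (simp add: b_def field_simps)
  qed
qed

text \<open>Cauchy-Schwarz against each basis vector kills every coordinate of
  \<open>M *v y\<close>.\<close>

lemma psd_kernel:
  assumes "psd M" "Re (quad_form M y) = 0"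
  shows "M *v y = 0"
proof -
  have "sesq M (axis i 1) y = 0" for i
    using psd_cauchy_schwarz[OF assms(1), of "axis i 1" y] assms(2) by simp
  moreover have "sesq M (axis i 1) y = (M *v y) $ i" for i
    by (simp add: sesq_def axis_def if_distrib[of cnj] if_distrib[of "\<lambda>x. x * _"] cong: if_cong)
  ultimately show ?thesis by (simp add: vec_eq_iff)
qed

lemma quad_form_diff: "quad_form (M - N) x = quad_form M x - quad_form N x"
  by (simp add: quad_form_expand algebra_simps sum_subtractf)

lemma quad_form_axis: "quad_form M (axis i 1) = M $ i $ i"
  by (simp add: quad_form_expand axis_def if_distrib[of cnj] if_distrib[of "\<lambda>x. x * _"]
      if_distrib[of "\<lambda>x. _ * x"] cong: if_cong)

definition diag_mat :: "real^'n \<Rightarrow> complex^'n^'n" where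
  "diag_mat d = (\<chi> i j. if i = j then of_real (d $ i) else 0)"

lemma diag_mat_mult: "(diag_mat d *v x) $ i = of_real (d $ i) * x $ i"
  by (simp add: diag_mat_def matrix_vector_mult_def if_distrib[of "\<lambda>x. x * _"] cong: if_cong)

lemma Re_quad_form_diag_mat: "Re (quad_form (diag_mat d) x) = (\<Sum>i\<in>UNIV. d $ i * (cmod (x $ i))\<^sup>2)"
proof -
  have "quad_form (diag_mat d) x = (\<Sum>i\<in>UNIV. of_real (d $ i * (cmod (x $ i))\<^sup>2))"
    unfolding quad_form_def diag_mat_mult of_real_mult complex_norm_square by (simp add: mult_ac)
  then show ?thesis by simp
qed

text \<open>The Loewner condition as a family of closed half-spaces in \<open>d\<close>, so that
  optimisation takes place in \<open>real^'n\<close>.\<close>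

definition feasible :: "complex^'n^'n \<Rightarrow> (real^'n) set" where
  "feasible A = {d. \<forall>x. Re (quad_form A x) \<le> (\<Sum>i\<in>UNIV. d $ i * (cmod (x $ i))\<^sup>2)}"

lemma diag_mat_loewner_iff:
  assumes "hermitian A"
  shows "diag_mat d \<succeq> A \<longleftrightarrow> d \<in> feasible A"
proof -
  have "hermitian (diag_mat d)" by (simp add: hermitian_iff diag_mat_def)
  moreover have "hermitian (diag_mat d - A)"
    using assms \<open>hermitian (diag_mat d)\<close> by (simp add: hermitian_iff)
  ultimately show ?thesis
    using assms by (simp add: loewner_ge_def psd_def feasible_def quad_form_diff Re_quad_form_diag_mat)
qed

text \<open>The relation \<open>\<succeq>\<close> makes \<open>D\<close> hermitian, hence its
  diagonal real.\<close>

lemma diagonal_loewnerE: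
  assumes "diagonal D" "D \<succeq> A"
  obtains d where "D = diag_mat d" "d \<in> feasible A"
proof -
  have herm: "hermitian A" using assms by (simp add: loewner_ge_def)
  have "D $ i $ i \<in> \<real>" for i
    using assms(2) by (auto simp: loewner_ge_def hermitian_iff Reals_cnj_iff)
  moreover define d where "d = (\<chi> i. Re (D $ i $ i))"
  ultimately have D: "D = diag_mat d"
    using assms(1) by (auto simp: vec_eq_iff diag_mat_def diagonal_def of_real_Re)
  then have "d \<in> feasible A"
    using assms(2) diag_mat_loewner_iff[OF herm] by simp
  with D show thesis by (rule that)
qed

lemma rel_eq_Inf_feasible:
  assumes "hermitian A"
  shows "rel A = Inf ((\<lambda>d. \<Prod>i\<in>UNIV. d $ i) ` feasible A)"
proof -
  have per: "Re (per (diag_mat d)) = (\<Prod>i\<in>UNIV. d $ i)" for d :: "real^'n"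
  proof -
    have "per (diag_mat d) = of_real (\<Prod>i\<in>UNIV. d $ i)"
      by (subst per_diagonal) (auto simp: diagonal_def diag_mat_def)
    then show ?thesis by (simp only: Re_complex_of_real)
  qed
  have "{Re (per D) | D. diagonal D \<and> D \<succeq> A} = (\<lambda>d. \<Prod>i\<in>UNIV. d $ i) ` feasible A"
  proof (intro set_eqI iffI)
    fix r assume "r \<in> {Re (per D) | D. diagonal D \<and> D \<succeq> A}"
    then obtain D where D: "r = Re (per D)" "diagonal D" "D \<succeq> A" by blast
    then show "r \<in> (\<lambda>d. \<Prod>i\<in>UNIV. d $ i) ` feasible A"
      by (auto simp: per elim!: diagonal_loewnerE)
  next
    fix r assume "r \<in> (\<lambda>d. \<Prod>i\<in>UNIV. d $ i) ` feasible A"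
    then obtain d where "r = Re (per (diag_mat d))" "d \<in> feasible A" by (auto simp: per)
    moreover have "diagonal (diag_mat d)" by (simp add: diagonal_def diag_mat_def)
    ultimately show "r \<in> {Re (per D) | D. diagonal D \<and> D \<succeq> A}"
      using diag_mat_loewner_iff[OF assms] by blast
  qed
  then show ?thesis by (simp add: rel_def)
qed

lemma feasible_nonempty:
  assumes "psd A"
  shows "feasible A \<noteq> {}"
proof -
  from rel_set_nonempty[OF assms] obtain D where "diagonal D" "D \<succeq> A" by blast
  then show ?thesis by (auto elim: diagonal_loewnerE)
qed

lemma feasible_ge_diag:
  assumes "d \<in> feasible A"
  shows "Re (A $ i $ i) \<le> d $ i"
proof -
  have "Re (quad_form A (axis i 1)) \<le> (\<Sum>j\<in>UNIV. d $ j * (cmod (axis i 1 $ j))\<^sup>2)"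
    using assms by (auto simp: feasible_def)
  also have "\<dots> = d $ i"
    by (simp add: axis_def if_distrib[of cmod] if_distrib[of "\<lambda>x. x\<^sup>2"] if_distrib[of "\<lambda>x. _ * x"] cong: if_cong)
  finally show ?thesis by (simp add: quad_form_axis)
qed

lemma feasible_nonneg:
  assumes "psd A" "d \<in> feasible A"
  shows "0 \<le> d $ i"
  using feasible_ge_diag[OF assms(2)] psd_diag_nonneg(2)[OF assms(1)] order_trans by blast

lemma rel_le_prod:
  assumes "psd A" "d \<in> feasible A"
  shows "rel A \<le> (\<Prod>i\<in>UNIV. d $ i)"
proof -
  have "hermitian A" using assms by (simp add: psd_def)
  moreover have "bdd_below ((\<lambda>d. \<Prod>i\<in>UNIV. d $ i) ` feasible A)"
    using feasible_nonneg[OF assms(1)] by (intro bdd_belowI[of _ 0]) (auto intro!: prod_nonneg)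
  ultimately show ?thesis
    using assms(2) by (auto simp: rel_eq_Inf_feasible intro: cINF_lower)
qed

section \<open>Degenerate diagonals and attainment of the infimum\<close>

text \<open>A vanishing diagonal entry of a positive semidefinite matrix forces its whole row and
  column to vanish. The corresponding entry of any feasible \<open>d\<close> can then be lowered to
  0.\<close>

lemma rel_nonpos_of_zero_diag:
  fixes A :: "complex^'n^'n"
  assumes "psd A" "Re (A $ k $ k) = 0"
  shows "rel A \<le> 0"
proof -
  have herm: "cnj (A $ i $ j) = A $ j $ i" for i j
    using assms(1) by (simp add: psd_def hermitian_iff)
  have "A *v axis k 1 = 0"
    using assms by (intro psd_kernel) (auto simp: quad_form_axis)
  then have col: "A $ i $ k = 0" for i
    by (simp add: vec_eq_iff matrix_vector_mult_def axis_def if_distrib[of "\<lambda>x. _ * x"] cong: if_cong)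
  then have row: "A $ k $ i = 0" for i
    using herm[of i k] by simp
  obtain d where d: "d \<in> feasible A" using feasible_nonempty[OF assms(1)] by blast
  define d' where "d' = (\<chi> i. if i = k then 0 else d $ i)"
  have "Re (quad_form A x) \<le> (\<Sum>i\<in>UNIV. d' $ i * (cmod (x $ i))\<^sup>2)" for x
  proof -
    define x' where "x' = (\<chi> i. if i = k then 0 else x $ i)"
    have "quad_form A x = quad_form A x'"
      unfolding quad_form_expand by (intro sum.cong refl) (auto simp: x'_def row col)
    then have "Re (quad_form A x) \<le> (\<Sum>i\<in>UNIV. d $ i * (cmod (x' $ i))\<^sup>2)"
      using d by (auto simp: feasible_def)
    also have "\<dots> = (\<Sum>i\<in>UNIV. d' $ i * (cmod (x $ i))\<^sup>2)"
      by (intro sum.cong refl) (auto simp: x'_def d'_def)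
    finally show ?thesis .
  qed
  then have "d' \<in> feasible A" by (simp add: feasible_def)
  from rel_le_prod[OF assms(1) this] have "rel A \<le> (\<Prod>i\<in>UNIV. d' $ i)" .
  also have "\<dots> = 0" by (intro prod_zero) (auto simp: d'_def)
  finally show ?thesis .
qed

text \<open>Feasible entries are bounded below by the positive diagonal of \<open>A\<close>, so an
  upper bound on the product bounds each entry from above. The sublevel set \<open>C\<close> of the
  product is therefore compact.\<close>

lemma feasible_attains_rel:
  fixes A :: "complex^'n^'n"
  assumes "psd A" and diag: "\<And>i. 0 < Re (A $ i $ i)"
  obtains d where "d \<in> feasible A" "rel A = (\<Prod>i\<in>UNIV. d $ i)"
proof -
  obtain d0 where d0: "d0 \<in> feasible A" using feasible_nonempty[OF assms(1)] by blast
  define P where "P = (\<Prod>i\<in>UNIV. d0 $ i)"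
  define a where "a i = Re (A $ i $ i)" for i
  have a: "0 < a i" for i using diag by (simp add: a_def)
  define C where "C = feasible A \<inter> {d. (\<Prod>i\<in>UNIV. d $ i) \<le> P}"
  have "closed (feasible A)"
    unfolding feasible_def by (intro closed_Collect_all closed_Collect_le continuous_intros)
  then have "closed C"
    unfolding C_def by (intro closed_Int closed_Collect_le continuous_intros) auto
  moreover have "bounded C"
  proof -
    have "norm d \<le> (\<Sum>i\<in>UNIV. P / (\<Prod>j\<in>UNIV - {i}. a j))" if "d \<in> C" for d
    proof -
      have d: "a i \<le> d $ i" for i
        using that feasible_ge_diag by (auto simp: C_def a_def)
      have "\<bar>d $ i\<bar> \<le> P / (\<Prod>j\<in>UNIV - {i}. a j)" for i
      proof -
        have "d $ i * (\<Prod>j\<in>UNIV - {i}. a j) \<le> d $ i * (\<Prod>j\<in>UNIV - {i}. d $ j)"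
          using d a less_le_trans[OF a d] by (intro mult_left_mono prod_mono) (auto simp: less_imp_le)
        also have "\<dots> = (\<Prod>i\<in>UNIV. d $ i)" by (rule prod.remove[symmetric]) auto
        also have "\<dots> \<le> P" using that by (simp add: C_def)
        finally have "d $ i \<le> P / (\<Prod>j\<in>UNIV - {i}. a j)"
          using a by (simp add: pos_le_divide_eq prod_pos)
        then show ?thesis using less_le_trans[OF a d, of i] by simp
      qed
      then show ?thesis
        by (intro order_trans[OF norm_le_l1_cart] sum_mono) auto
    qed
    then show ?thesis by (rule boundedI)
  qed
  ultimately have "compact C" by (simp add: compact_eq_bounded_closed)
  moreover have "C \<noteq> {}" using d0 by (auto simp: C_def P_def)
  moreover have "continuous_on C (\<lambda>d. \<Prod>i\<in>UNIV. d $ i)" by (intro continuous_intros)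
  ultimately obtain d where d: "d \<in> C" "\<And>e. e \<in> C \<Longrightarrow> (\<Prod>i\<in>UNIV. d $ i) \<le> (\<Prod>i\<in>UNIV. e $ i)"
    using continuous_attains_inf[of C "\<lambda>d. \<Prod>i\<in>UNIV. d $ i"] by blast
  have min: "(\<Prod>i\<in>UNIV. d $ i) \<le> (\<Prod>i\<in>UNIV. e $ i)" if "e \<in> feasible A" for e
    using d that by (cases "e \<in> C") (auto simp: C_def)
  have "hermitian A" using assms by (simp add: psd_def)
  then have "(\<Prod>i\<in>UNIV. d $ i) \<le> rel A"
    using min d0 by (auto simp: rel_eq_Inf_feasible intro!: cINF_greatest)
  moreover have "d \<in> feasible A" using d by (simp add: C_def)
  ultimately show thesis
    using rel_le_prod[OF assms(1)] that by force
qed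


section \<open>Tight vectors and first-order optimality\<close>

lemma continuous_on_quad_form [continuous_intros]: "continuous_on S (quad_form M)"
  unfolding quad_form_expand by (intro continuous_intros)

lemma compact_ellipsoid:
  fixes d :: "real^'n"
  assumes d: "\<And>i. 0 < d $ i"
  shows "compact {x :: complex^'n. (\<Sum>i\<in>UNIV. d $ i * (cmod (x $ i))\<^sup>2) = 1}"
proof -
  have "norm x \<le> (\<Sum>i\<in>UNIV. sqrt (1 / d $ i))"
    if x: "(\<Sum>i\<in>UNIV. d $ i * (cmod (x $ i))\<^sup>2) = 1" for x :: "complex^'n"
  proof -
    have "cmod (x $ i) \<le> sqrt (1 / d $ i)" for i
    proof (rule real_le_rsqrt)
      have "d $ i * (cmod (x $ i))\<^sup>2 \<le> (\<Sum>i\<in>UNIV. d $ i * (cmod (x $ i))\<^sup>2)"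
        using d by (intro member_le_sum) (auto simp: less_imp_le)
      then show "(cmod (x $ i))\<^sup>2 \<le> 1 / d $ i"
        using d[of i] x by (simp add: field_simps)
    qed
    then have "(\<Sum>i\<in>UNIV. cmod (x $ i)) \<le> (\<Sum>i\<in>UNIV. sqrt (1 / d $ i))"
      by (intro sum_mono)
    moreover have "norm x \<le> (\<Sum>i\<in>UNIV. cmod (x $ i))"
      unfolding norm_vec_def by (rule L2_set_le_sum) auto
    ultimately show ?thesis by simp
  qed
  then have "bounded {x :: complex^'n. (\<Sum>i\<in>UNIV. d $ i * (cmod (x $ i))\<^sup>2) = 1}"
    by (intro boundedI) auto
  moreover have "closed {x :: complex^'n. (\<Sum>i\<in>UNIV. d $ i * (cmod (x $ i))\<^sup>2) = 1}"
    by (intro closed_Collect_eq continuous_intros)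
  ultimately show ?thesis by (simp add: compact_eq_bounded_closed)
qed

text \<open>For hermitian \<open>A\<close> and feasible \<open>d\<close>, these are the normalised
  vectors at which the constraint defining \<open>feasible\<close> is an equality. The kernel
  equation displays them as the unit vectors of a linear subspace, for the norm weighted by
  \<open>d\<close>.\<close>

definition tight :: "complex^'n^'n \<Rightarrow> real^'n \<Rightarrow> (complex^'n) set" where
  "tight A d = {w. A *v w = diag_mat d *v w \<and> (\<Sum>i\<in>UNIV. d $ i * (cmod (w $ i))\<^sup>2) = 1}"

text \<open>The gradient of the constraint at \<open>w\<close> with respect to the logarithms of the
  \<open>d $ i\<close>; on \<open>tight A d\<close> its entries sum to 1.\<close>

definition weights :: "real^'n \<Rightarrow> complex^'n \<Rightarrow> real^'n" where
  "weights d w = (\<chi> i. d $ i * (cmod (w $ i))\<^sup>2)"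

lemma compact_tight:
  fixes A :: "complex^'n^'n"
  assumes d: "\<And>i. 0 < d $ i"
  shows "compact (tight A d)"
proof -
  have "tight A d = {w. (\<Sum>i\<in>UNIV. d $ i * (cmod (w $ i))\<^sup>2) = 1} \<inter> {w. A *v w = diag_mat d *v w}"
    by (auto simp: tight_def)
  moreover have "closed {w. A *v w = diag_mat d *v w}"
    unfolding matrix_vector_mult_def by (intro closed_Collect_eq continuous_intros)
  ultimately show ?thesis
    by (simp add: compact_Int_closed compact_ellipsoid[OF d])
qed

text \<open>The first-order optimality condition: if the barycentre were not a convex combination of the
  weight vectors, a separating hyperplane would give a direction in which \<open>d\<close> can be perturbed
  within the feasible set so as to decrease the product.\<close>

lemma optimal_barycentre:
  fixes A :: "complex^'n^'n"
  assumes A: "psd A" and diag: "\<And>i. 0 < Re (A $ i $ i)"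
    and d: "d \<in> feasible A" and opt: "rel A = (\<Prod>i\<in>UNIV. d $ i)"
  shows "(\<chi> i. 1 / CARD('n)) \<in> convex hull (weights d ` tight A d)"
proof (rule ccontr)
  assume not_in: "(\<chi> i. 1 / CARD('n)) \<notin> convex hull (weights d ` tight A d)"
  have herm: "hermitian A" using A by (simp add: psd_def)
  have dpos: "0 < d $ i" for i
    using less_le_trans[OF diag feasible_ge_diag[OF d]] .
  define N where "N x = (\<Sum>i\<in>UNIV. d $ i * (cmod (x $ i))\<^sup>2)" for x :: "complex^'n"
  have cont: "continuous_on S (weights d)" for S
    unfolding weights_def by (intro continuous_intros)
  have "compact (convex hull (weights d ` tight A d))"
    by (intro compact_convex_hull compact_continuous_image cont compact_tight dpos)
  from separating_hyperplane_closed_point[OF convex_convex_hull compact_imp_closed[OF this] not_in]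
  obtain a b where ab: "a \<bullet> (\<chi> i. 1 / CARD('n)) < b"
      "\<And>k. k \<in> convex hull (weights d ` tight A d) \<Longrightarrow> b < a \<bullet> k"
    by blast
  define Q where "Q x = N x - Re (quad_form A x)" for x
  \<comment> \<open>\<open>R\<close> is the rate of change of \<open>N\<close> when each
    \<open>d $ i\<close> is multiplied by \<open>1 + t * (a $ i - b)\<close>, and \<open>Q\<close>
    is the slack of the constraint. Since weights of tight vectors sum to 1, subtracting
    \<open>b\<close> moves the separation threshold to 0.\<close>
  define R where "R x = (\<Sum>i\<in>UNIV. (a $ i - b) * (d $ i * (cmod (x $ i))\<^sup>2))" for x :: "complex^'n"
  have Q_nonneg: "0 \<le> Q x" for x
    using d by (simp add: Q_def N_def feasible_def)
  have R_pos: "0 < R x" if "N x = 1" "Q x = 0" for x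
  proof -
    have "psd (diag_mat d - A)"
      using diag_mat_loewner_iff[OF herm, of d] d by (simp add: loewner_ge_def)
    moreover have "Re (quad_form (diag_mat d - A) x) = 0"
      using that by (simp add: quad_form_diff Re_quad_form_diag_mat Q_def N_def)
    ultimately have "(diag_mat d - A) *v x = 0" by (rule psd_kernel)
    then have "x \<in> tight A d"
      using that by (simp add: tight_def matrix_vector_mult_diff_rdistrib N_def)
    then have "b < a \<bullet> weights d x"
      by (intro ab hull_inc) auto
    moreover have "R x = a \<bullet> weights d x - b * N x"
      by (simp add: R_def N_def weights_def inner_vec_def algebra_simps sum_subtractf sum_distrib_left)
    ultimately show ?thesis using that by simp
  qed
  \<comment> \<open>Zero slack forces \<open>R\<close> to be positive, so the continuous slack is
    positive on the compact set where \<open>R\<close> is not, and has a positive minimum there. If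
    that set is empty, any positive \<open>q\<close> serves.\<close>
  obtain q where q: "0 < q" "\<And>x. N x = 1 \<Longrightarrow> R x \<le> 0 \<Longrightarrow> q \<le> Q x"
  proof -
    let ?S = "{x. N x = 1} \<inter> {x. R x \<le> 0}"
    have "closed {x. R x \<le> 0}"
      unfolding R_def by (intro closed_Collect_le continuous_intros)
    then have "compact ?S"
      unfolding N_def by (intro compact_Int_closed compact_ellipsoid dpos)
    moreover have "continuous_on ?S Q"
      unfolding Q_def N_def by (intro continuous_intros)
    moreover have "0 < Q x" if "x \<in> ?S" for x
      using that R_pos[of x] Q_nonneg[of x] by force
    ultimately show thesis
    proof (cases "?S = {}")
      case True
      then show thesis by (intro that[of 1]) auto
    next
      case False
      with \<open>compact ?S\<close> \<open>continuous_on ?S Q\<close> obtain x where x: "x \<in> ?S" "\<forall>y\<in>?S. Q x \<le> Q y"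
        using continuous_attains_inf[of ?S Q] by blast
      with \<open>\<And>x. x \<in> ?S \<Longrightarrow> 0 < Q x\<close> show thesis by (intro that[of "Q x"]) auto
    qed
  qed
  define r where "r = (\<Sum>i\<in>UNIV. \<bar>a $ i - b\<bar>)"
  have r: "0 \<le> r" by (simp add: r_def sum_nonneg)
  have R_ge: "- r \<le> R x" if "N x = 1" for x
  proof -
    have "d $ i * (cmod (x $ i))\<^sup>2 \<le> N x" for i
      unfolding N_def using dpos by (intro member_le_sum) (auto simp: less_imp_le)
    then have "\<bar>a $ i - b\<bar> * (d $ i * (cmod (x $ i))\<^sup>2) \<le> \<bar>a $ i - b\<bar> * 1" for i
      using that by (intro mult_left_mono) auto
    then have "\<bar>R x\<bar> \<le> r"
      unfolding R_def r_def using dpos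
      by (intro order_trans[OF sum_abs] sum_mono) (auto simp: abs_mult less_imp_le)
    then show ?thesis by simp
  qed
  \<comment> \<open>Small enough that the loss \<open>t * r\<close> never exceeds the slack
    \<open>q\<close>; adding 1 keeps the denominator positive.\<close>
  define t where "t = q / (r + 1)"
  have t: "0 < t" "t * r \<le> q"
    using q r by (auto simp: t_def field_simps)
  have QR: "0 \<le> Q x + t * R x" if "N x = 1" for x
  proof (cases "R x \<le> 0")
    case True
    have "t * (- r) \<le> t * R x" using t R_ge[OF that] by (intro mult_left_mono) auto
    with t q(2)[OF that True] show ?thesis by simp
  next
    case False
    with t Q_nonneg[of x] show ?thesis by simp
  qed
  define y where "y i = 1 + t * (a $ i - b)" for i
  define e where "e = (\<chi> i. d $ i * y i)"
  have "Re (quad_form A x) \<le> (\<Sum>i\<in>UNIV. e $ i * (cmod (x $ i))\<^sup>2)" for x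
  proof (cases "x = 0")
    case True
    then show ?thesis by (simp add: quad_form_def)
  next
    case False
    then obtain k where "x $ k \<noteq> 0" by (auto simp: vec_eq_iff)
    then have "0 < N x"
      unfolding N_def using dpos by (intro sum_pos2[of _ k]) (auto simp: less_imp_le)
    \<comment> \<open>Both sides scale by \<open>(cmod c)\<^sup>2\<close>, so it suffices to treat
      vectors with \<open>N\<close> equal to 1.\<close>
    define c where "c = complex_of_real (1 / sqrt (N x))"
    have c: "(cmod c)\<^sup>2 = 1 / N x"
      using \<open>0 < N x\<close> by (simp add: c_def norm_divide power_divide)
    have cx: "(cmod ((c *s x) $ i))\<^sup>2 = (cmod c)\<^sup>2 * (cmod (x $ i))\<^sup>2" for i
      by (simp add: norm_mult power_mult_distrib)
    have "N (c *s x) = (cmod c)\<^sup>2 * N x"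
      unfolding N_def cx by (simp add: sum_distrib_left mult_ac)
    then have 1: "N (c *s x) = 1" using \<open>0 < N x\<close> c by simp
    have e_eq: "(\<Sum>i\<in>UNIV. e $ i * (cmod (z $ i))\<^sup>2) = N z + t * R z" for z
      by (simp add: e_def y_def N_def R_def algebra_simps sum.distrib sum_subtractf sum_distrib_left)
    have "Re (quad_form A (c *s x)) \<le> (\<Sum>i\<in>UNIV. e $ i * (cmod ((c *s x) $ i))\<^sup>2)"
      using QR[OF 1] unfolding e_eq by (simp add: Q_def)
    then have "(cmod c)\<^sup>2 * Re (quad_form A x) \<le> (cmod c)\<^sup>2 * (\<Sum>i\<in>UNIV. e $ i * (cmod (x $ i))\<^sup>2)"
      unfolding cx quad_form_scale by (simp add: sum_distrib_left mult_ac)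
    then show ?thesis
      using \<open>0 < N x\<close> c by (subst (asm) mult_le_cancel_left_pos) auto
  qed
  then have e: "e \<in> feasible A" by (simp add: feasible_def)
  \<comment> \<open>Positivity of the factors comes from feasibility of \<open>e\<close> and the
    positive diagonal of \<open>A\<close>.\<close>
  have ypos: "0 < y i" for i
  proof -
    have "0 < d $ i * y i"
      using less_le_trans[OF diag feasible_ge_diag[OF e, of i]] by (simp add: e_def)
    then show ?thesis using dpos[of i] by (simp add: zero_less_mult_iff)
  qed
  \<comment> \<open>The product is at most the exponential of the sum of \<open>y i - 1\<close>,
    which is negative because the barycentre lies below the threshold \<open>b\<close>.\<close>
  have "(\<Prod>i\<in>UNIV. y i) \<le> (\<Prod>i\<in>UNIV. exp (y i - 1))"
    using ypos exp_ge_add_one_self[of "y i - 1" for i] by (intro prod_mono) (auto simp: less_imp_le)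
  also have "\<dots> = exp (\<Sum>i\<in>UNIV. y i - 1)" by (simp add: exp_sum)
  also have "(\<Sum>i\<in>UNIV. y i - 1) = t * CARD('n) * (a \<bullet> (\<chi> i. 1 / CARD('n)) - b)"
    by (simp add: y_def inner_vec_def sum_subtractf sum_divide_distrib[symmetric] algebra_simps sum_distrib_left[symmetric])
  also have "exp \<dots> < 1"
    using t ab(1) by (simp add: mult_less_0_iff)
  finally have "(\<Prod>i\<in>UNIV. y i) < 1" .
  moreover have "0 < (\<Prod>i\<in>UNIV. d $ i)" using dpos by (intro prod_pos) auto
  ultimately have "(\<Prod>i\<in>UNIV. e $ i) < (\<Prod>i\<in>UNIV. d $ i)"
    by (simp add: e_def prod.distrib)
  with rel_le_prod[OF A e] opt show False by simp
qed

section \<open>The Gaussian vector in the tight eigenspace\<close>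

text \<open>The convex coefficients of the barycentre become the variances of independent Gaussian
  coefficients, up to the factor \<open>CARD('n)\<close>; the barycentre condition says exactly that
  all coordinates then have unit variance.\<close>

lemma tight_prod_ge_of_gt:
  fixes A :: "complex^'n^'n"
  assumes d: "\<And>i. 0 < d $ i"
    and bary: "(\<chi> i. 1 / CARD('n)) \<in> convex hull (weights d ` tight A d)"
    and c: "euler_mascheroni < c"
  shows "\<exists>v\<in>tight A d. (exp (- c) / CARD('n)) ^ CARD('n) \<le> (\<Prod>i\<in>UNIV. weights d v $ i)"
proof -
  let ?n = "real CARD('n)"
  from bary obtain S l where S: "finite S" "S \<subseteq> weights d ` tight A d" and l: "\<And>k. k \<in> S \<Longrightarrow> 0 \<le> l k"
    and sum: "(\<Sum>k\<in>S. l k *\<^sub>R k) = (\<chi> i. 1 / ?n)"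
    unfolding convex_hull_explicit by blast
  from S(2) have "\<forall>k\<in>S. \<exists>w. w \<in> tight A d \<and> k = weights d w" by blast
  then obtain w where w: "\<And>k. k \<in> S \<Longrightarrow> w k \<in> tight A d" "\<And>k. k \<in> S \<Longrightarrow> k = weights d (w k)"
    by metis
  \<comment> \<open>The factor \<open>?n\<close> compensates the barycentre entries
    \<open>1 / ?n\<close>, and \<open>sqrt (d $ i)\<close> absorbs the weighting, so each row has
    unit length.\<close>
  define u where "u i k = of_real (sqrt (d $ i) * sqrt (?n * l k)) * w k $ i" for i k
  have "(\<Sum>k\<in>S. (cmod (u i k))\<^sup>2) = 1" for i
  proof -
    have "(cmod (u i k))\<^sup>2 = ?n * (l k *\<^sub>R k) $ i" if "k \<in> S" for k
    proof -
      have "(cmod (u i k))\<^sup>2 = d $ i * (?n * l k) * (cmod (w k $ i))\<^sup>2"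
        using d[of i] l[OF that] by (simp add: u_def norm_mult power_mult_distrib)
      moreover have "k $ i = d $ i * (cmod (w k $ i))\<^sup>2"
        by (subst w(2)[OF that]) (simp add: weights_def)
      ultimately show ?thesis by simp
    qed
    then have "(\<Sum>k\<in>S. (cmod (u i k))\<^sup>2) = ?n * (\<Sum>k\<in>S. l k *\<^sub>R k) $ i"
      by (simp add: sum_distrib_left)
    then show ?thesis by (simp add: sum)
  qed
  from gauss_combination_prod_ge[of UNIV S u c, OF _ _ S(1) this c] obtain x where
    pos: "\<And>i. 0 < (cmod (\<Sum>k\<in>S. u i k * x k))\<^sup>2" and
    ge: "exp (- c) ^ CARD('n) * ((\<Sum>i\<in>UNIV. (cmod (\<Sum>k\<in>S. u i k * x k))\<^sup>2) / ?n) ^ CARD('n)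
      \<le> (\<Prod>i\<in>UNIV. (cmod (\<Sum>k\<in>S. u i k * x k))\<^sup>2)"
    by auto
  define v where "v = (\<Sum>k\<in>S. (of_real (sqrt (?n * l k)) * x k) *s w k)"
  have p: "(cmod (\<Sum>k\<in>S. u i k * x k))\<^sup>2 = weights d v $ i" for i
  proof -
    have "(\<Sum>k\<in>S. u i k * x k) = of_real (sqrt (d $ i)) * v $ i"
      by (simp add: u_def v_def sum_distrib_left mult_ac)
    then show ?thesis
      using d[of i] by (simp add: weights_def norm_mult power_mult_distrib)
  qed
  have lin: "M *v v = (\<Sum>k\<in>S. (of_real (sqrt (?n * l k)) * x k) *s (M *v w k))" for M :: "complex^'n^'n"
    unfolding v_def
    by (simp add: linear_sum[OF matrix_vector_mul_linear] vector_scalar_commute)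
  \<comment> \<open>The kernel equation is linear, so it passes to the random combination; only the
    normalisation has to be restored, by the scalar \<open>a\<close> below.\<close>
  have Av: "A *v v = diag_mat d *v v"
    unfolding lin using w(1) by (intro sum.cong) (auto simp: tight_def)
  define N where "N = (\<Sum>i\<in>UNIV. weights d v $ i)"
  have N: "0 < N" unfolding N_def using pos by (intro sum_pos) (auto simp: p)
  define a where "a = complex_of_real (1 / sqrt N)"
  have wa: "weights d (a *s v) $ i = weights d v $ i / N" for i
    using N by (simp add: weights_def a_def norm_mult norm_divide power_mult_distrib power_divide)
  have "a *s v \<in> tight A d"
  proof -
    have "(\<Sum>i\<in>UNIV. weights d (a *s v) $ i) = 1"
      unfolding wa using N by (simp add: N_def flip: sum_divide_distrib)
    then show ?thesis
      by (simp add: tight_def weights_def vector_scalar_commute Av)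
  qed
  moreover have "(exp (- c) / ?n) ^ CARD('n) \<le> (\<Prod>i\<in>UNIV. weights d (a *s v) $ i)"
  proof -
    have "(exp (- c) / ?n) ^ CARD('n) * N ^ CARD('n) \<le> (\<Prod>i\<in>UNIV. weights d v $ i)"
      using ge by (simp add: p N_def power_divide)
    then show ?thesis
      unfolding wa using N by (simp add: prod_dividef pos_le_divide_eq)
  qed
  ultimately show ?thesis by blast
qed

text \<open>A maximiser on the compact set \<open>tight A d\<close> satisfies the bound for every
  \<open>c\<close> above Euler's constant at once, so \<open>c\<close> can tend to it.\<close>

lemma tight_prod_ge:
  fixes A :: "complex^'n^'n"
  assumes d: "\<And>i. 0 < d $ i"
    and bary: "(\<chi> i. 1 / CARD('n)) \<in> convex hull (weights d ` tight A d)"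
  shows "\<exists>v\<in>tight A d. (exp (- euler_mascheroni) / CARD('n)) ^ CARD('n) \<le> (\<Prod>i\<in>UNIV. weights d v $ i)"
proof -
  have "tight A d \<noteq> {}" using bary by auto
  moreover have "continuous_on (tight A d) (\<lambda>v. \<Prod>i\<in>UNIV. weights d v $ i)"
    unfolding weights_def by (auto intro!: continuous_intros)
  ultimately obtain v where v: "v \<in> tight A d"
    and max: "\<And>w. w \<in> tight A d \<Longrightarrow> (\<Prod>i\<in>UNIV. weights d w $ i) \<le> (\<Prod>i\<in>UNIV. weights d v $ i)"
    using continuous_attains_sup[OF compact_tight[OF d, where A = A]] by blast
  have "(exp (- euler_mascheroni) / CARD('n)) ^ CARD('n) \<le> (\<Prod>i\<in>UNIV. weights d v $ i)"
  proof (rule tendsto_upperbound)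
    show "((\<lambda>c. (exp (- c) / CARD('n)) ^ CARD('n)) \<longlongrightarrow> (exp (- euler_mascheroni) / CARD('n)) ^ CARD('n))
        (at_right (euler_mascheroni :: real))"
      by (auto intro!: tendsto_intros)
    show "\<forall>\<^sub>F c in at_right (euler_mascheroni :: real).
        (exp (- c) / CARD('n)) ^ CARD('n) \<le> (\<Prod>i\<in>UNIV. weights d v $ i)"
      using eventually_at_right_less
    proof eventually_elim
      case (elim c)
      from tight_prod_ge_of_gt[OF d bary elim] max show ?case by (meson order_trans)
    qed
  qed simp
  with v show ?thesis by blast
qed

section \<open>The rank-one minorant and the final estimate\<close>

text \<open>The form of \<open>outer (A *v v)\<close> at \<open>x\<close> is the squared modulus of
  \<open>sesq A x v\<close>. Cauchy-Schwarz bounds it by the form of \<open>A\<close> at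
  \<open>x\<close>, because the form of \<open>A\<close> at a tight vector is 1.\<close>

lemma outer_loewner_of_tight:
  assumes A: "psd A" and v: "v \<in> tight A d"
  shows "A \<succeq> outer (diag_mat d *v v)"
proof -
  define y where "y = diag_mat d *v v"
  have hA: "hermitian A" using A by (simp add: psd_def)
  have ho: "hermitian (outer y)" by (simp add: hermitian_iff outer_def)
  have hd: "hermitian (A - outer y)" using hA ho by (simp add: hermitian_iff)
  have Av: "A *v v = y" using v by (simp add: tight_def y_def)
  have "quad_form A v = quad_form (diag_mat d) v"
    using v by (simp add: quad_form_def tight_def)
  then have Qv: "Re (quad_form A v) = 1"
    using v by (simp add: Re_quad_form_diag_mat tight_def)
  have "0 \<le> Re (quad_form (A - outer y) x)" for x
  proof -
    have "quad_form (outer y) x = sesq A x v * cnj (sesq A x v)"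
      unfolding sesq_def Av quad_form_expand cnj_sum sum_product by (simp add: outer_def mult_ac)
    then have "Re (quad_form (outer y) x) = (cmod (sesq A x v))\<^sup>2"
      by (simp add: complex_norm_square[symmetric] del: of_real_power)
    also have "\<dots> \<le> Re (quad_form A x)"
      using psd_cauchy_schwarz[OF A, of x v] by (simp add: Qv)
    finally show ?thesis by (simp add: quad_form_diff)
  qed
  then show ?thesis
    using hA ho hd by (simp add: loewner_ge_def psd_def y_def)
qed

text \<open>The term of index \<open>n\<close> in the exponential series at \<open>n\<close> is at
  most the whole sum.\<close>

lemma power_self_le_exp_fact: "real n ^ n \<le> exp (real n) * fact n"
proof -
  have sums: "(\<lambda>k. real n ^ k /\<^sub>R fact k) sums exp (real n)"
    by (rule exp_converges)
  have "(\<Sum>k\<in>{n}. real n ^ k /\<^sub>R fact k) \<le> exp (real n)"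
    unfolding sums_unique[OF sums]
    by (rule sum_le_suminf[OF sums_summable[OF sums]]) auto
  then show ?thesis by (simp add: field_simps)
qed

theorem theorem3p1:
  fixes A :: "complex^'n^'n"
  assumes "hermitian A" and "psd A"
  shows "\<exists>v :: complex^'n. A \<succeq> outer v \<and>
           (exp (euler_mascheroni + 1 :: real)) ^ CARD('n) * Re (per (outer v)) \<ge> rel A"
proof (cases "\<exists>k. Re (A $ k $ k) = 0")
  case True
  then have "rel A \<le> 0" using rel_nonpos_of_zero_diag[OF assms(2)] by blast
  moreover have "A \<succeq> outer 0"
    using assms by (simp add: loewner_ge_def hermitian_iff psd_def outer_def quad_form_expand)
  moreover have "Re (per (outer (0 :: complex^'n))) = 0"
    unfolding per_outer by simp
  ultimately show ?thesis by (intro exI[of _ 0]) simp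
next
  case False
  then have diag: "0 < Re (A $ i $ i)" for i
    using psd_diag_nonneg(2)[OF assms(2), of i] by (metis order_le_less)
  obtain d where d: "d \<in> feasible A" and opt: "rel A = (\<Prod>i\<in>UNIV. d $ i)"
    using feasible_attains_rel[OF assms(2) diag] by blast
  have dpos: "0 < d $ i" for i
    using less_le_trans[OF diag feasible_ge_diag[OF d]] .
  from tight_prod_ge[OF dpos optimal_barycentre[OF assms(2) diag d opt]]
  obtain v where v: "v \<in> tight A d"
    and ge: "(exp (- euler_mascheroni) / CARD('n)) ^ CARD('n) \<le> (\<Prod>i\<in>UNIV. weights d v $ i)"
    by blast
  let ?n = "CARD('n)" and ?g = "euler_mascheroni :: real"
  \<comment> \<open>Each squared entry is \<open>(d $ i)\<^sup>2 * (cmod (v $ i))\<^sup>2\<close>;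
    splitting off one factor \<open>d $ i\<close> produces \<open>rel A\<close>, and the rest is the
    weight.\<close>
  have "(\<Prod>i\<in>UNIV. (cmod ((diag_mat d *v v) $ i))\<^sup>2) = (\<Prod>i\<in>UNIV. d $ i * weights d v $ i)"
    using dpos by (simp add: diag_mat_mult weights_def norm_mult power_mult_distrib power2_eq_square less_imp_le mult_ac)
  then have per: "Re (per (outer (diag_mat d *v v))) = fact ?n * (rel A * (\<Prod>i\<in>UNIV. weights d v $ i))"
    by (simp only: per_outer Re_complex_of_real prod.distrib opt)
  have rel: "0 \<le> rel A" unfolding opt using dpos by (intro prod_nonneg) (auto simp: less_imp_le)
  \<comment> \<open>The summand 1 in the exponent of the constant pays for
    \<open>?n ^ ?n / fact ?n\<close>, and Euler's constant pays for the Gaussian loss in the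
    weights.\<close>
  have "1 \<le> exp (real ?n) * fact ?n / real ?n ^ ?n"
    using power_self_le_exp_fact[of ?n] by (simp add: field_simps)
  also have "\<dots> = exp (?g + 1) ^ ?n * fact ?n * (exp (- ?g) / ?n) ^ ?n"
    by (simp add: power_divide exp_of_nat_mult[symmetric] mult_exp_exp algebra_simps)
  also have "\<dots> \<le> exp (?g + 1) ^ ?n * fact ?n * (\<Prod>i\<in>UNIV. weights d v $ i)"
    using ge by (intro mult_left_mono) auto
  finally have "rel A * 1 \<le> rel A * (exp (?g + 1) ^ ?n * fact ?n * (\<Prod>i\<in>UNIV. weights d v $ i))"
    using rel by (intro mult_left_mono)
  then have "rel A \<le> exp (?g + 1) ^ ?n * Re (per (outer (diag_mat d *v v)))"
    unfolding per by (simp add: mult_ac)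
  with outer_loewner_of_tight[OF assms(2) v] show ?thesis by blast
qed

end
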